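(* Let $n\ge 3$, let $\mathbf{Q}=(Q_1,\dots,Q_n)$ be a plane $n$-gon, and let $t>0$ be less than half of the length of every side $|Q_iQ_{i+1}|$ of $\mathbf{Q}$. Then there exists a unique $n$-gon $\mathbf{P}$ such that $q_t(\mathbf{P})=\mathbf{Q}$.
   Context: A plane $n$-gon is an $n$-tuple of points in $\mathbb{R}^2$, indices cyclic mod $n$. For an $n$-gon $\mathbf{P}=(P_1,\dots,P_n)$ with $P_i\neq P_{i+1}$ for all $i$, $q_t(\mathbf{P})=\mathbf{Q}$ is defined by $$Q_i=P_i+t\,\frac{P_i-P_{i-1}}{|P_i-P_{i-1}|},\quad i=1,\dots,n.$$ *)

theory Defs
  imports "HOL-Analysis.Analysis"
begin

definition ngon :: "nat \<Rightarrow> (real^2) list \<Rightarrow> bool" where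
  "ngon n P \<longleftrightarrow> length P = n"

text \<open>Cyclic indexing: \<open>i\<close> is any integer, read modulo the number of vertices. List positions
  start at 0, so for the list of \<open>P\<^sub>1, \<dots>, P\<^sub>n\<close> the value \<open>vertex P i\<close> is \<open>P\<^sub>i\<^sub>+\<^sub>1\<close>;
  all notions below commute with this index shift.\<close>

definition vertex :: "(real^2) list \<Rightarrow> int \<Rightarrow> real^2" where
  "vertex P i = P ! nat (i mod int (length P))"

text \<open>The domain of the map \<open>q t\<close>.\<close>

definition nonzero_sides :: "(real^2) list \<Rightarrow> bool" where
  "nonzero_sides P \<longleftrightarrow> (\<forall>i. vertex P i \<noteq> vertex P (i + 1))"

text \<open>Only meaningful on polygons satisfying \<^const>\<open>nonzero_sides\<close>; elsewhere the convention
  \<open>inverse 0 = 0\<close> applies.\<close>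

definition q :: "real \<Rightarrow> (real^2) list \<Rightarrow> (real^2) list" where
  "q t P = map (\<lambda>i. vertex P (int i)
        + t *\<^sub>R ((vertex P (int i) - vertex P (int i - 1))
                 /\<^sub>R norm (vertex P (int i) - vertex P (int i - 1)))) [0..<length P]"

end

theory Submission
  imports Defs
begin

text \<open>If \<open>q t P = Q\<close>, then \<open>P\<^sub>i\<close> lies on the segment from \<open>P\<^sub>i\<^sub>-\<^sub>1\<close> to \<open>Q\<^sub>i\<close> at distance
  \<open>t\<close> from \<open>Q\<^sub>i\<close>, so it is the radial projection of \<open>P\<^sub>i\<^sub>-\<^sub>1\<close> onto the circle of radius \<open>t\<close>
  around \<open>Q\<^sub>i\<close>. Since \<open>P\<^sub>i\<^sub>-\<^sub>1\<close> is at distance at most \<open>t\<close> from \<open>Q\<^sub>i\<^sub>-\<^sub>1\<close>, it is at distance at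
  least some \<open>r > t\<close> from \<open>Q\<^sub>i\<close>, and there the projection is a contraction with factor \<open>t / r\<close>.
  Going once around the polygon gives a contraction of a disc, whose unique fixed point is the
  last vertex of \<open>P\<close>.\<close>

definition radial_proj :: "real \<Rightarrow> 'a::real_normed_vector \<Rightarrow> 'a \<Rightarrow> 'a" where
  "radial_proj t c x = c + t *\<^sub>R sgn (x - c)"

text \<open>Only an inequality, because at \<open>x = c\<close> the convention
  \<open>sgn 0 = 0\<close> returns the centre itself.\<close>

lemma dist_radial_proj_le: "0 \<le> t \<Longrightarrow> dist (radial_proj t c x) c \<le> t"
  by (simp add: radial_proj_def dist_norm norm_sgn)

text \<open>By the law of cosines the squared distance of \<open>x\<close> and \<open>y\<close> is
  \<open>(a - b)^2\<close> plus \<open>a * b\<close> times the squared distance of their directions,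
  and \<open>a * b\<close> is at least \<open>r^2\<close>.\<close>

lemma dist_sgn_le:
  fixes x y :: "'a::real_inner"
  assumes "0 < r" "r \<le> norm x" "r \<le> norm y"
  shows "dist (sgn x) (sgn y) \<le> dist x y / r"
proof -
  define a b s where "a = norm x" and "b = norm y" and "s = sgn x \<bullet> sgn y"
  have pos: "0 < a" "0 < b" using assms by (auto simp: a_def b_def)
  have x: "x = a *\<^sub>R sgn x" and y: "y = b *\<^sub>R sgn y"
    using pos by (auto simp: a_def b_def sgn_div_norm)
  have [simp]: "sgn x \<bullet> sgn x = 1" "sgn y \<bullet> sgn y = 1"
    using pos by (auto simp: a_def b_def dot_square_norm norm_sgn)
  have sgn_sq: "(dist (sgn x) (sgn y))\<^sup>2 = 2 - 2 * s"
    by (simp add: dist_norm power2_norm_eq_inner inner_diff s_def inner_commute)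
  have "(dist x y)\<^sup>2 = (a *\<^sub>R sgn x - b *\<^sub>R sgn y) \<bullet> (a *\<^sub>R sgn x - b *\<^sub>R sgn y)"
    using x y by (simp add: dist_norm power2_norm_eq_inner)
  also have "\<dots> = (a - b)\<^sup>2 + a * b * (2 - 2 * s)"
    by (simp add: inner_diff s_def inner_commute power2_eq_square algebra_simps)
  finally have "a * b * (2 - 2 * s) \<le> (dist x y)\<^sup>2" by simp
  \<comment> \<open>The factor \<open>2 - 2 * s\<close> is nonnegative since it is the square in
    \<open>sgn_sq\<close>.\<close>
  moreover have "r\<^sup>2 * (2 - 2 * s) \<le> a * b * (2 - 2 * s)"
    unfolding power2_eq_square using assms pos
    by (intro mult_mono) (auto simp: a_def b_def simp flip: sgn_sq)
  ultimately have "(r * dist (sgn x) (sgn y))\<^sup>2 \<le> (dist x y)\<^sup>2"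
    by (simp add: power_mult_distrib sgn_sq)
  then have "r * dist (sgn x) (sgn y) \<le> dist x y"
    by (rule power2_le_imp_le) simp
  then show ?thesis using assms(1) by (simp add: field_simps)
qed

lemma dist_radial_proj_contract:
  fixes x y c :: "'a::real_inner"
  assumes "0 \<le> t" "0 < r" "r \<le> dist x c" "r \<le> dist y c"
  shows "dist (radial_proj t c x) (radial_proj t c y) \<le> t / r * dist x y"
proof -
  have "dist (radial_proj t c x) (radial_proj t c y) = t * dist (sgn (x - c)) (sgn (y - c))"
    using assms(1) by (simp add: radial_proj_def dist_norm flip: scaleR_diff_right)
  also have "\<dots> \<le> t * (dist (x - c) (y - c) / r)"
    using assms by (intro mult_left_mono dist_sgn_le) (auto simp: dist_norm)
  finally show ?thesis by (simp add: dist_norm)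
qed

text \<open>Under either side, \<open>p - x\<close> is a negative multiple of \<open>x - c\<close>,
  so the two directions are opposite. That \<open>x\<close> lies outside the circle keeps its
  projection from reaching or passing \<open>x\<close>.\<close>

lemma radial_proj_iff:
  assumes "0 < t" "t < dist x c"
  shows "x \<noteq> p \<and> p + t *\<^sub>R sgn (p - x) = c \<longleftrightarrow> p = radial_proj t c x"
proof
  assume "x \<noteq> p \<and> p + t *\<^sub>R sgn (p - x) = c"
  then have ne: "norm (p - x) > 0" and c: "c = p + t *\<^sub>R sgn (p - x)" by auto
  have "x - c = - ((1 + t / norm (p - x)) *\<^sub>R (p - x))"
    by (simp add: c sgn_div_norm algebra_simps divide_inverse)
  moreover have "1 + t / norm (p - x) > 0" using assms(1) ne by (simp add: add_pos_pos)
  ultimately have "sgn (x - c) = - sgn (p - x)"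
    by (simp only: sgn_minus sgn_scaleR) simp
  then show "p = radial_proj t c x" by (simp add: radial_proj_def c)
next
  assume p: "p = radial_proj t c x"
  have px: "p - x = - ((1 - t / norm (x - c)) *\<^sub>R (x - c))"
    by (simp add: p radial_proj_def sgn_div_norm algebra_simps divide_inverse)
  have pos: "1 - t / norm (x - c) > 0" using assms by (simp add: dist_norm divide_less_eq)
  have "p - x \<noteq> 0" unfolding px using pos assms by auto
  moreover have "sgn (p - x) = - sgn (x - c)"
    unfolding px using pos by (simp only: sgn_minus sgn_scaleR) simp
  ultimately show "x \<noteq> p \<and> p + t *\<^sub>R sgn (p - x) = c"
    by (simp add: p radial_proj_def)
qed

lemma vertex_cong:
  "i mod int (length P) = j mod int (length P) \<Longrightarrow> vertex P i = vertex P j"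
  by (simp add: vertex_def)

lemma vertex_eq_nth: "i < length P \<Longrightarrow> vertex P (int i) = P ! i"
  by (simp add: vertex_def)

lemma vertex_q:
  assumes "P \<noteq> []"
  shows "vertex (q t P) i = vertex P i + t *\<^sub>R sgn (vertex P i - vertex P (i - 1))"
proof -
  let ?n = "int (length P)"
  have n: "0 < ?n" using assms by simp
  have "vertex P (i mod ?n) = vertex P i" "vertex P (i mod ?n - 1) = vertex P (i - 1)"
    by (rule vertex_cong; simp add: mod_diff_left_eq)+
  then show ?thesis
    using n by (simp add: vertex_def[where P = "map _ _"] q_def sgn_div_norm nat_less_iff)
qed

lemma polygon_eqI:
  assumes "length P = length Q" "\<And>i. vertex P i = vertex Q i"
  shows "P = Q"
  using assms by (metis nth_equalityI vertex_eq_nth)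

lemma length_q [simp]: "length (q t P) = length P"
  by (simp add: q_def)

text \<open>Passing between the two equations at \<open>i\<close> requires vertex
  \<open>i - 1\<close> of \<open>P\<close> to be far from vertex \<open>i\<close> of
  \<open>Q\<close>. This follows from either equation at \<open>i - 1\<close>, so the families are
  compared as a whole.\<close>

lemma q_eq_iff_radial_proj:
  assumes "length P = length Q" "Q \<noteq> []" "0 < t"
    and sides: "\<And>i. 2 * t < dist (vertex Q i) (vertex Q (i + 1))"
  shows "nonzero_sides P \<and> q t P = Q \<longleftrightarrow>
    (\<forall>i. vertex P i = radial_proj t (vertex Q i) (vertex P (i - 1)))"
    (is "?L \<longleftrightarrow> (\<forall>i. ?R i)")
proof -
  have ne: "P \<noteq> []" using assms by auto
  have "?L \<longleftrightarrow> (\<forall>i. vertex P (i - 1) \<noteq> vertex P i) \<and> (\<forall>i. vertex (q t P) i = vertex Q i)"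
    using assms(1) polygon_eqI[of "q t P" Q] unfolding nonzero_sides_def
    by (metis length_q add_diff_cancel_right' diff_add_cancel)
  then have L: "?L \<longleftrightarrow> (\<forall>i. vertex P (i - 1) \<noteq> vertex P i \<and>
      vertex P i + t *\<^sub>R sgn (vertex P i - vertex P (i - 1)) = vertex Q i)" (is "_ \<longleftrightarrow> (\<forall>i. ?M i)")
    by (auto simp: vertex_q[OF ne])
  have near: "dist (vertex P i) (vertex Q i) \<le> t" if "?M i \<or> ?R i" for i
    using that
  proof
    assume "?M i"
    then have "vertex Q i = vertex P i + t *\<^sub>R sgn (vertex P i - vertex P (i - 1))" by simp
    then show ?thesis using assms(3) by (simp add: dist_norm norm_sgn)
  next
    assume "?R i"
    then show ?thesis using assms(3) dist_radial_proj_le by (metis less_imp_le)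
  qed
  \<comment> \<open>The premise follows from each of the two families, so this one claim yields both
    implications.\<close>
  have "?M i \<longleftrightarrow> ?R i" if "\<forall>j. ?M j \<or> ?R j" for i
  proof (rule radial_proj_iff[OF assms(3)])
    have "dist (vertex P (i - 1)) (vertex Q (i - 1)) \<le> t" using near that by blast
    then show "t < dist (vertex P (i - 1)) (vertex Q i)"
      using sides[of "i - 1"] dist_triangle2[of "vertex Q (i - 1)" "vertex Q i" "vertex P (i - 1)"]
      by (simp add: dist_commute)
  qed
  then show ?thesis unfolding L by blast
qed

primrec radial_orbit :: "real \<Rightarrow> (nat \<Rightarrow> 'a::real_normed_vector) \<Rightarrow> nat \<Rightarrow> 'a \<Rightarrow> 'a" where
  "radial_orbit t c 0 x = x"
| "radial_orbit t c (Suc i) x = radial_proj t (c i) (radial_orbit t c i x)"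

text \<open>The point \<open>b\<close> acts as the centre preceding \<open>c 0\<close>: each iterate
  is within \<open>t\<close> of the preceding centre, hence at least \<open>r\<close> from the next
  one, and every step contracts by \<open>t / r\<close>.\<close>

lemma radial_orbit_contract:
  fixes c :: "nat \<Rightarrow> 'a::real_inner"
  assumes "0 \<le> t" "0 < r" "t + r \<le> dist b (c 0)" "\<And>i. t + r \<le> dist (c i) (c (Suc i))"
    and "dist x b \<le> t" "dist y b \<le> t"
  shows "dist (radial_orbit t c i x) (radial_orbit t c i y) \<le> (t / r) ^ i * dist x y"
proof (induction i)
  case (Suc i)
  have far: "r \<le> dist (radial_orbit t c i z) (c i)" if "dist z b \<le> t" for z
  proof (cases i)
    case 0
    then show ?thesis using that assms(3) dist_triangle2[of b "c 0" z] by (simp add: dist_commute)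
  next
    case (Suc j)
    then show ?thesis
      using assms(4)[of j] dist_radial_proj_le[OF assms(1), of "c j" "radial_orbit t c j z"]
        dist_triangle2[of "c j" "c i" "radial_orbit t c i z"] by (simp add: dist_commute)
  qed
  have "dist (radial_orbit t c (Suc i) x) (radial_orbit t c (Suc i) y)
      \<le> t / r * dist (radial_orbit t c i x) (radial_orbit t c i y)"
    unfolding radial_orbit.simps using assms far by (intro dist_radial_proj_contract) auto
  also have "\<dots> \<le> t / r * ((t / r) ^ i * dist x y)"
    using Suc assms by (intro mult_left_mono) auto
  finally show ?case by (simp add: mult.assoc)
qed simp

lemma ex1_radial_orbit_fixpoint:
  fixes c :: "nat \<Rightarrow> 'a::{real_inner, complete_space}"
  assumes "0 < t" "t < r" "\<And>i. t + r \<le> dist (c i) (c (Suc i))" "c n = c 0" "0 < n"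
  shows "\<exists>!x. radial_orbit t c n x = x"
proof -
  obtain m where n: "n = Suc m" using assms(5) by (cases n) auto
  let ?b = "c m"
  \<comment> \<open>Since \<open>c n = c 0\<close>, the last centre \<open>c m\<close> precedes
    \<open>c 0\<close> cyclically.\<close>
  have b: "t + r \<le> dist ?b (c 0)" using assms(3)[of m] assms(4) n by simp
  have mem: "radial_orbit t c n x \<in> cball ?b t" for x
    using dist_radial_proj_le[of t ?b] assms(1) by (simp add: n dist_commute)
  have "\<exists>!x\<in>cball ?b t. radial_orbit t c n x = x"
  proof (rule Banach_fix)
    show "complete (cball ?b t)" by (simp add: complete_eq_closed)
    show "cball ?b t \<noteq> {}" "0 \<le> (t / r) ^ n" using assms(1,2) by simp_all
    show "(t / r) ^ n < 1" using assms(1,2,5) by (simp add: power_less_one_iff)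
    show "dist (radial_orbit t c n x) (radial_orbit t c n y) \<le> (t / r) ^ n * dist x y"
      if "x \<in> cball ?b t" "y \<in> cball ?b t" for x y
      using that assms(1-3) b by (intro radial_orbit_contract) (simp_all add: dist_commute)
  qed (simp add: image_subset_iff mem del: mem_cball)
  \<comment> \<open>A fixed point is its own image and so lies in the disc; uniqueness thus extends
    to the whole space.\<close>
  moreover have "x \<in> cball ?b t" if "radial_orbit t c n x = x" for x
    using mem[of x] unfolding that .
  ultimately show ?thesis by blast
qed

text \<open>Cyclic indexing yields only finitely many sides, so a shortest one exists;
  \<open>r\<close> is its length minus \<open>t\<close>.\<close>

lemma ex_uniform_side_bound:
  assumes "Q \<noteq> []" "\<And>i. 2 * t < dist (vertex Q i) (vertex Q (i + 1))"
  obtains r where "t < r" "\<And>i. t + r \<le> dist (vertex Q i) (vertex Q (i + 1))"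
proof -
  let ?D = "(\<lambda>(u, v). dist u v) ` range (\<lambda>i. (vertex Q i, vertex Q (i + 1)))"
  have "range (vertex Q) \<subseteq> set Q"
    using assms(1) by (auto simp: vertex_def nat_less_iff)
  then have "range (\<lambda>i. (vertex Q i, vertex Q (i + 1))) \<subseteq> set Q \<times> set Q" by auto
  then have "finite ?D" by (meson finite_SigmaI finite_imageI finite_set finite_subset)
  then have "Min ?D \<in> ?D" "\<And>i. Min ?D \<le> dist (vertex Q i) (vertex Q (i + 1))"
    by (auto intro!: Min_in Min_le)
  then show thesis using assms(2) by (intro that[of "Min ?D - t"]) fastforce+
qed

theorem lemma2p1:
  fixes n :: nat and Q :: "(real^2) list" and t :: real
  assumes "n \<ge> 3"
    and "ngon n Q"
    and "t > 0"
    and "\<And>i. t < dist (vertex Q i) (vertex Q (i + 1)) / 2"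
  shows "\<exists>!P. ngon n P \<and> nonzero_sides P \<and> q t P = Q"
proof -
  have n: "0 < n" and lenQ: "length Q = n" and Q: "Q \<noteq> []"
    using assms(1,2) by (auto simp: ngon_def)
  have sides: "2 * t < dist (vertex Q i) (vertex Q (i + 1))" for i using assms(4)[of i] by simp
  obtain r where r: "t < r" "\<And>i. t + r \<le> dist (vertex Q i) (vertex Q (i + 1))"
    using ex_uniform_side_bound[OF Q sides] by blast
  \<comment> \<open>If vertex \<open>-1\<close> (the last one) of \<open>P\<close> is
    \<open>x\<close>, then vertex \<open>i - 1\<close> must be \<open>g i x\<close>; closing up
    means \<open>g n x = x\<close>.\<close>
  define g where "g = radial_orbit t (\<lambda>i. vertex Q (int i))"
  have g_simps: "g 0 x = x" "g (Suc i) x = radial_proj t (vertex Q (int i)) (g i x)" for i x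
    by (simp_all add: g_def)
  have "\<exists>!x. g n x = x"
    unfolding g_def
  proof (rule ex1_radial_orbit_fixpoint[OF assms(3) r(1) _ _ n])
    show "t + r \<le> dist (vertex Q (int i)) (vertex Q (int (Suc i)))" for i
      using r(2)[of "int i"] by (simp add: add.commute)
    show "vertex Q (int n) = vertex Q (int 0)" by (rule vertex_cong) (simp add: lenQ)
  qed
  then obtain x where x: "g n x = x" and x_unique: "\<And>y. g n y = y \<Longrightarrow> y = x" by metis
  have sol_iff: "ngon n P \<and> nonzero_sides P \<and> q t P = Q \<longleftrightarrow> length P = n \<and>
      (\<forall>i. vertex P i = radial_proj t (vertex Q i) (vertex P (i - 1)))" for P
    using q_eq_iff_radial_proj[OF _ Q assms(3) sides, of P] lenQ by (auto simp: ngon_def)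
  show ?thesis
    unfolding sol_iff
  proof (rule ex1I, intro conjI allI)
    let ?P = "map (\<lambda>i. g (Suc i) x) [0..<n]"
    show len: "length ?P = n" by simp
    fix i :: int
    define k where "k = nat (i mod int n)"
    have k: "k < n" "int k = i mod int n" using n by (auto simp: k_def nat_less_iff)
    have P: "vertex ?P (int j) = g (Suc j) x" if "j < n" for j
      using that by (simp add: vertex_eq_nth)
    have prev: "vertex ?P (int k - 1) = g k x"
    proof (cases k)
      case 0
      \<comment> \<open>The wrap-around: the predecessor of vertex \<open>0\<close> is
        \<open>g n x\<close>, which equals \<open>g 0 x\<close> because \<open>x\<close> is
        fixed.\<close>
      have "vertex ?P (- 1) = vertex ?P (int (n - 1))"
        using n by (intro vertex_cong) (simp add: of_nat_diff zmod_minus1)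
      then show ?thesis using 0 n P[of "n - 1"] x by (simp add: g_simps(1))
    next
      case (Suc j)
      then show ?thesis using k(1) P[of j] by simp
    qed
    have "vertex ?P i = vertex ?P (int k)" "vertex ?P (i - 1) = vertex ?P (int k - 1)"
      "vertex Q i = vertex Q (int k)"
      by (rule vertex_cong; simp add: k lenQ mod_diff_left_eq)+
    then show "vertex ?P i = radial_proj t (vertex Q i) (vertex ?P (i - 1))"
      using P[OF k(1)] prev by (simp add: g_simps(2))
  next
    fix P
    assume "length P = n \<and> (\<forall>i. vertex P i = radial_proj t (vertex Q i) (vertex P (i - 1)))"
    then have len: "length P = n"
      and step: "vertex P i = radial_proj t (vertex Q i) (vertex P (i - 1))" for i
      by blast+
    have orbit: "vertex P (int j - 1) = g j (vertex P (- 1))" for j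
    proof (induction j)
      case (Suc j)
      then show ?case using step[of "int j"] by (simp add: g_simps(2))
    qed (simp add: g_simps)
    \<comment> \<open>One full turn returns to the starting vertex, so vertex \<open>-1\<close> of
      \<open>P\<close> is a fixed point of \<open>g n\<close>.\<close>
    have "vertex P (int n - 1) = vertex P (- 1)"
      by (rule vertex_cong) (simp add: len mod_diff_left_eq[of "int n" "int n" 1, symmetric])
    then have "vertex P (- 1) = x" using orbit[of n] x_unique by simp
    then have "P ! j = g (Suc j) x" if "j < n" for j
      using that len orbit[of "Suc j"] by (simp add: vertex_eq_nth)
    then show "P = map (\<lambda>i. g (Suc i) x) [0..<n]"
      using len by (intro nth_equalityI) auto
  qed
qed

end
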